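(* Let $G$ be a surjunctive group and let $k$ be a field. Suppose that $\alpha, \beta \in R(k,G)$ satisfy $\alpha \star \beta = X_{1_G}$. Then $\beta \star \alpha = X_{1_G}$.
   Context: Let $G$ be a group with identity $1_G$ and let $k$ be a field. The near ring $(R(k,G),+,\star)$ is defined as follows. As an additive group, $R(k,G) = k[X_g : g \in G]$, the commutative polynomial ring in indeterminates indexed by $G$. Let $\mathbb{N}[G]$ be the set of functions $u \colon G \to \mathbb{N}$ (with $0 \in \mathbb{N}$) such that $u(g) \neq 0$ for only finitely many $g \in G$. For $u \in \mathbb{N}[G]$ put $X^u = \prod_{g \in G} X_g^{u(g)}$ (with $X_g^0 = 1$). Every element of $R(k,G)$ is uniquely of the form $\sum_{u \in \mathbb{N}[G]} \alpha(u) X^u$ with $\alpha(u) \in k$ and $\alpha(u) \neq 0$ for finitely many $u$. The group $G$ acts on $\mathbb{N}[G]$ by $(gu)(h) = u(g^{-1}h)$ and on $R(k,G)$ by $g\gamma = \sum_{w} \gamma(w) X^{gw}$ for $\gamma = \sum_w \gamma(w) X^w$ (so $g X_h = X_{gh}$). For $\alpha = \sum_u \alpha(u) X^u$ and $\beta \in R(k,G)$, the multiplication is $$\alpha \star \beta = \sum_{u \in \mathbb{N}[G]} \alpha(u) \prod_{g \in G} (g\beta)^{u(g)},$$ where the products and powers on the right are the usual ones in the polynomial ring. The element $X_{1_G}$ is the identity for $\star$. For a set $A$ and a group $G$, $A^G$ is the set of maps $c \colon G \to A$, with the action of $G$ given by $(gc)(h) = c(g^{-1}h)$. A cellular automaton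 over the group $G$ and the alphabet $A$ is a map $\tau \colon A^G \to A^G$ for which there exist a finite subset $M \subset G$ and a map $\mu \colon A^M \to A$ such that $(\tau(c))(g) = \mu((g^{-1}c)|_M)$ for all $c \in A^G$ and $g \in G$. A group $G$ is surjunctive if for every finite set $A$, every injective cellular automaton $\tau \colon A^G \to A^G$ is surjective. *)

theory Defs
  imports "HOL-Algebra.Group" "HOL-Library.Poly_Mapping"
begin

section \<open>The near ring of a group\<close>

text \<open>The set of finitely supported functions from the group to the naturals.  They are
  represented on the whole type, extended by 0 outside the carrier.\<close>

definition exponents :: "('a, 'b) monoid_scheme \<Rightarrow> ('a \<Rightarrow>\<^sub>0 nat) set" where
  "exponents G = {u. Poly_Mapping.keys u \<subseteq> carrier G}"

text \<open>The type \<open>('a \<Rightarrow>\<^sub>0 nat) \<Rightarrow>\<^sub>0 'k\<close>, with the convolution product of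
  \<open>HOL-Library.Poly_Mapping\<close>, is the commutative polynomial ring in indeterminates indexed by
  the whole type \<open>'a\<close>; \<open>near_ring G\<close> consists of those polynomials that only involve
  indeterminates indexed by the carrier of \<open>G\<close>.\<close>

definition near_ring :: "('a, 'b) monoid_scheme \<Rightarrow> (('a \<Rightarrow>\<^sub>0 nat) \<Rightarrow>\<^sub>0 'k::field) set" where
  "near_ring G = {\<gamma>. Poly_Mapping.keys \<gamma> \<subseteq> exponents G}"

definition Const :: "'k::field \<Rightarrow> ('a \<Rightarrow>\<^sub>0 nat) \<Rightarrow>\<^sub>0 'k" where
  "Const c = Poly_Mapping.single 0 c"

definition X :: "'a \<Rightarrow> ('a \<Rightarrow>\<^sub>0 nat) \<Rightarrow>\<^sub>0 'k::field" where
  "X g = Poly_Mapping.single (Poly_Mapping.single g 1) 1"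

definition monomial :: "('a \<Rightarrow>\<^sub>0 nat) \<Rightarrow> ('a \<Rightarrow>\<^sub>0 nat) \<Rightarrow>\<^sub>0 'k::field" where
  "monomial u = (\<Prod>g\<in>Poly_Mapping.keys u. X g ^ Poly_Mapping.lookup u g)"

definition act_exp :: "('a, 'b) monoid_scheme \<Rightarrow> 'a \<Rightarrow> ('a \<Rightarrow>\<^sub>0 nat) \<Rightarrow> ('a \<Rightarrow>\<^sub>0 nat)" where
  "act_exp G g u = Poly_Mapping.Abs_poly_mapping
     (\<lambda>h. if h \<in> carrier G then Poly_Mapping.lookup u (inv\<^bsub>G\<^esub> g \<otimes>\<^bsub>G\<^esub> h) else 0)"

definition act :: "('a, 'b) monoid_scheme \<Rightarrow> 'a
    \<Rightarrow> (('a \<Rightarrow>\<^sub>0 nat) \<Rightarrow>\<^sub>0 'k::field) \<Rightarrow> (('a \<Rightarrow>\<^sub>0 nat) \<Rightarrow>\<^sub>0 'k)" where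
  "act G g \<gamma> =
     (\<Sum>w\<in>Poly_Mapping.keys \<gamma>. Const (Poly_Mapping.lookup \<gamma> w) * monomial (act_exp G g w))"

definition star :: "('a, 'b) monoid_scheme \<Rightarrow> (('a \<Rightarrow>\<^sub>0 nat) \<Rightarrow>\<^sub>0 'k::field)
    \<Rightarrow> (('a \<Rightarrow>\<^sub>0 nat) \<Rightarrow>\<^sub>0 'k) \<Rightarrow> (('a \<Rightarrow>\<^sub>0 nat) \<Rightarrow>\<^sub>0 'k)" where
  "star G \<alpha> \<beta> = (\<Sum>u\<in>Poly_Mapping.keys \<alpha>. Const (Poly_Mapping.lookup \<alpha> u) *
     (\<Prod>g\<in>Poly_Mapping.keys u. act G g \<beta> ^ Poly_Mapping.lookup u g))"

lemma monomial_eq_single: "monomial u = Poly_Mapping.single u (1::'k::field)"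
proof -
  have pow: "X g ^ n = Poly_Mapping.single (Poly_Mapping.single g n) (1::'k)" for g :: 'a and n
    by (induction n) (simp_all add: X_def mult_single flip: single_add single_one)
  have "(\<Prod>g\<in>S. X g ^ Poly_Mapping.lookup u g) =
      Poly_Mapping.single (\<Sum>g\<in>S. Poly_Mapping.single g (Poly_Mapping.lookup u g)) (1::'k)"
    if "finite S" for S
    using that by (induction S) (simp_all add: pow mult_single)
  moreover have "(\<Sum>g\<in>Poly_Mapping.keys u. Poly_Mapping.single g (Poly_Mapping.lookup u g)) = u"
    by (rule poly_mapping_eqI)
       (simp add: lookup_sum lookup_single when_def in_keys_iff sum.delta)
  ultimately show ?thesis
    by (simp add: monomial_def)
qed

text \<open>The function passed to \<open>Abs_poly_mapping\<close> in the definition of \<open>act_exp\<close> does have finite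
  support.\<close>

lemma lookup_act_exp:
  fixes G (structure)
  assumes "group G" and "g \<in> carrier G"
  shows "Poly_Mapping.lookup (act_exp G g u) h =
    (if h \<in> carrier G then Poly_Mapping.lookup u (inv g \<otimes> h) else 0)"
proof -
  interpret group G by fact
  let ?f = "\<lambda>h. if h \<in> carrier G then Poly_Mapping.lookup u (inv g \<otimes> h) else 0"
  have "{h. ?f h \<noteq> 0} \<subseteq> (\<lambda>h. g \<otimes> h) ` Poly_Mapping.keys u"
  proof
    fix h assume "h \<in> {h. ?f h \<noteq> 0}"
    then have h: "h \<in> carrier G" "inv g \<otimes> h \<in> Poly_Mapping.keys u"
      by (auto simp: in_keys_iff split: if_splits)
    moreover have "h = g \<otimes> (inv g \<otimes> h)"
      using h assms(2) by (simp flip: m_assoc)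
    ultimately show "h \<in> (\<lambda>h. g \<otimes> h) ` Poly_Mapping.keys u" by blast
  qed
  then have "finite {h. ?f h \<noteq> 0}"
    by (rule finite_subset) simp
  then show ?thesis
    by (simp add: act_exp_def)
qed

section \<open>Cellular automata and surjunctive groups\<close>

definition configs :: "('a, 'b) monoid_scheme \<Rightarrow> 'c set \<Rightarrow> ('a \<Rightarrow> 'c) set" where
  "configs G A = carrier G \<rightarrow>\<^sub>E A"

definition shift :: "('a, 'b) monoid_scheme \<Rightarrow> 'a \<Rightarrow> ('a \<Rightarrow> 'c) \<Rightarrow> 'a \<Rightarrow> 'c" where
  "shift G g c = (\<lambda>h\<in>carrier G. c (inv\<^bsub>G\<^esub> g \<otimes>\<^bsub>G\<^esub> h))"

definition cellular_automaton ::
    "('a, 'b) monoid_scheme \<Rightarrow> 'c set \<Rightarrow> (('a \<Rightarrow> 'c) \<Rightarrow> ('a \<Rightarrow> 'c)) \<Rightarrow> bool" where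
  "cellular_automaton G A \<tau> \<longleftrightarrow> \<tau> \<in> configs G A \<rightarrow> configs G A \<and>
     (\<exists>M \<mu>. M \<subseteq> carrier G \<and> finite M \<and> \<mu> \<in> (M \<rightarrow>\<^sub>E A) \<rightarrow> A \<and>
        (\<forall>c\<in>configs G A. \<forall>g\<in>carrier G. \<tau> c g = \<mu> (restrict (shift G (inv\<^bsub>G\<^esub> g) c) M)))"

text \<open>HOL cannot quantify over the element type of the alphabet inside a definition, so alphabets
  range over the finite sets of natural numbers.  As every finite set is in bijection with one of
  these, this is no restriction; see \<open>surjunctiveD\<close> below.\<close>

definition surjunctive :: "('a, 'b) monoid_scheme \<Rightarrow> bool" where
  "surjunctive G \<longleftrightarrow> (\<forall>(A :: nat set) \<tau>. finite A \<longrightarrow> cellular_automaton G A \<tau> \<longrightarrow>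
     inj_on \<tau> (configs G A) \<longrightarrow> \<tau> ` configs G A = configs G A)"

lemma surjunctiveD:
  fixes G (structure) and A :: "'c set"
  assumes "group G" and surj: "surjunctive G" and "finite A"
    and ca: "cellular_automaton G A \<tau>" and inj: "inj_on \<tau> (configs G A)"
  shows "\<tau> ` configs G A = configs G A"
proof -
  interpret group G by fact
  obtain e :: "'c \<Rightarrow> nat" and B where e: "bij_betw e A B" and B: "finite B"
    using ex_bij_betw_finite_nat[OF \<open>finite A\<close>] by blast
  define d where "d = inv_into A e"
  have ed: "\<And>b. b \<in> B \<Longrightarrow> e (d b) = b" and de: "\<And>a. a \<in> A \<Longrightarrow> d (e a) = a"
    and eB: "\<And>a. a \<in> A \<Longrightarrow> e a \<in> B" and dA: "\<And>b. b \<in> B \<Longrightarrow> d b \<in> A"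
    unfolding d_def using e bij_betw_inv_into_right[OF e] bij_betw_inv_into_left[OF e]
      bij_betwE[OF e] bij_betwE[OF bij_betw_inv_into[OF e]] by auto
  define E where "E = (\<lambda>c. \<lambda>h\<in>carrier G. e (c h))"
  define D where "D = (\<lambda>c. \<lambda>h\<in>carrier G. d (c h))"
  have E: "E c \<in> configs G B" "D (E c) = c" if "c \<in> configs G A" for c
    using that eB de unfolding E_def D_def configs_def
    by (auto simp: PiE_iff extensional_def fun_eq_iff)
  have D: "D c \<in> configs G A" "E (D c) = c" if "c \<in> configs G B" for c
    using that dA ed unfolding E_def D_def configs_def
    by (auto simp: PiE_iff extensional_def fun_eq_iff)
  from ca obtain M \<mu> where \<tau>: "\<tau> \<in> configs G A \<rightarrow> configs G A"
    and M: "M \<subseteq> carrier G" "finite M" and \<mu>: "\<mu> \<in> (M \<rightarrow>\<^sub>E A) \<rightarrow> A"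
    and eq: "\<And>c g. c \<in> configs G A \<Longrightarrow> g \<in> carrier G \<Longrightarrow>
      \<tau> c g = \<mu> (restrict (shift G (inv g) c) M)"
    unfolding cellular_automaton_def by blast
  define \<tau>' where "\<tau>' = (\<lambda>c. E (\<tau> (D c)))"
  define \<mu>' where "\<mu>' = (\<lambda>p. e (\<mu> (\<lambda>h\<in>M. d (p h))))"
  have \<tau>D: "\<tau> (D c) \<in> configs G A" if "c \<in> configs G B" for c
    using \<tau> D(1)[OF that] by auto
  have "\<mu>' \<in> (M \<rightarrow>\<^sub>E B) \<rightarrow> B"
    unfolding \<mu>'_def using \<mu> eB dA by (fastforce simp: PiE_iff Pi_iff)
  moreover have "\<tau>' c g = \<mu>' (restrict (shift G (inv g) c) M)"
    if c: "c \<in> configs G B" and g: "g \<in> carrier G" for c g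
  proof -
    have "restrict (shift G (inv g) (D c)) M
        = (\<lambda>h\<in>M. d (restrict (shift G (inv g) c) M h))"
      using M(1) g by (auto simp: fun_eq_iff shift_def D_def restrict_def)
    then show ?thesis
      unfolding \<tau>'_def \<mu>'_def E_def using g by (simp add: eq[OF D(1)[OF c] g])
  qed
  ultimately have "cellular_automaton G B \<tau>'"
    unfolding cellular_automaton_def using M E(1)[OF \<tau>D]
    by (intro conjI exI[of _ M] exI[of _ \<mu>']) (auto simp: \<tau>'_def)
  moreover have "inj_on \<tau>' (configs G B)"
    by (rule inj_onI) (metis D E(2) \<tau>D \<tau>'_def inj inj_onD)
  ultimately have im: "\<tau>' ` configs G B = configs G B"
    using surj B unfolding surjunctive_def by blast
  have "c \<in> \<tau> ` configs G A" if c: "c \<in> configs G A" for c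
  proof -
    obtain b where "b \<in> configs G B" "E c = \<tau>' b"
      using im E(1)[OF c] by blast
    then have "c = \<tau> (D b)"
      by (metis E(2) \<tau>D \<tau>'_def c)
    then show ?thesis
      using D(1)[OF \<open>b \<in> configs G B\<close>] by blast
  qed
  then show ?thesis
    using \<tau> by auto
qed

end

theory Submission
  imports Defs "HOL-Computational_Algebra.Polynomial" "HOL-Computational_Algebra.Primes"
begin

text \<open>An element \<open>\<gamma>\<close> of the near ring acts on configurations with values in a commutative ring by
  \<open>(\<tau>\<^sub>\<gamma> c) g = \<gamma>(c(g h))\<close>, where \<open>\<gamma>\<close> is evaluated by substituting \<open>c(g h)\<close> for the indeterminate of
  \<open>h\<close>.  The product \<open>\<star>\<close> is made so that \<open>\<tau>\<close> of \<open>\<alpha> \<star> \<beta>\<close> is \<open>\<tau>\<^sub>\<alpha> \<circ> \<tau>\<^sub>\<beta>\<close> (\<open>evaluate_star\<close>).  Over a finite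
  ring \<open>\<tau>\<^sub>\<gamma>\<close> is a cellular automaton.  If \<open>\<alpha> \<star> \<beta>\<close> is the identity, then \<open>\<tau>\<^sub>\<beta>\<close> is injective, hence
  surjective by surjunctivity, hence \<open>\<tau>\<^sub>\<alpha>\<close> is its two-sided inverse, and \<open>\<beta> \<star> \<alpha>\<close> acts as the identity.

  Two things separate this from a proof: the field need not be finite, and a nonzero polynomial may
  vanish at all points of a finite ring.  Both are overcome by one specialisation.  Suppose that
  \<open>\<delta> = \<beta> \<star> \<alpha> - X\<^sub>1\<close> is not zero.  The domain \<open>k[T]\<close> is infinite, and substituting suitable powers of
  \<open>T\<close> for the indeterminates gives a nonzero value \<open>r\<close> of \<open>\<delta>\<close> (\<open>nonvanishing_point\<close>).  The
  coefficients of \<open>\<alpha>\<close> and \<open>\<beta>\<close> together with \<open>T\<close> lie in a finitely generated subring \<open>R\<close> of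
  \<open>k[T]\<close>, and \<open>R\<close> has an ideal \<open>J\<close> of finite index that does not contain \<open>r\<close>
  (\<open>finite_subset_unit_mod_finite\<close>).  Over the finite ring \<open>R/J\<close> the argument above applies and says
  that \<open>\<delta>\<close> takes the value \<open>0\<close> at every configuration, in particular that \<open>r \<in> J\<close>: a
  contradiction.

  The ideal \<open>J\<close> is a form of the Nullstellensatz over the integers.  It is obtained by adjoining
  generators one at a time, with the property that every nonzero element is a unit modulo some
  proper ideal of finite index as the invariant (\<open>unit_mod_finite_adjoin\<close>).  Ideals of subrings are
  used throughout in place of quotient rings, and the alphabet consists of representatives of the
  cosets of \<open>J\<close>.\<close>

section \<open>Subrings and ideals of finite index\<close>

locale unital_subring =
  fixes A :: "'d::idom set"
  assumes one_closed: "1 \<in> A"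
    and diff_closed: "a \<in> A \<Longrightarrow> b \<in> A \<Longrightarrow> a - b \<in> A"
    and mult_closed: "a \<in> A \<Longrightarrow> b \<in> A \<Longrightarrow> a * b \<in> A"
begin

lemma zero_closed: "0 \<in> A"
  using diff_closed[OF one_closed one_closed] by simp

lemma power_closed: "a \<in> A \<Longrightarrow> a ^ n \<in> A"
  by (induction n) (auto intro: one_closed mult_closed)

lemma prod_closed: "(\<And>s. s \<in> S \<Longrightarrow> f s \<in> A) \<Longrightarrow> prod f S \<in> A"
  by (induction S rule: infinite_finite_induct) (auto intro: one_closed mult_closed)

end

locale ideal_in = unital_subring A for A :: "'d::idom set" +
  fixes I :: "'d set"
  assumes subset: "I \<subseteq> A"
    and ideal_zero: "0 \<in> I"
    and ideal_diff: "a \<in> I \<Longrightarrow> b \<in> I \<Longrightarrow> a - b \<in> I"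
    and ideal_mult: "a \<in> A \<Longrightarrow> b \<in> I \<Longrightarrow> a * b \<in> I"
begin

lemma ideal_add: "a \<in> I \<Longrightarrow> b \<in> I \<Longrightarrow> a + b \<in> I"
  using ideal_diff[of a "0 - b"] ideal_diff[of 0 b] ideal_zero by simp

lemma ideal_mult_right: "b \<in> I \<Longrightarrow> a \<in> A \<Longrightarrow> b * a \<in> I"
  using ideal_mult[of a b] by (simp add: mult.commute)

lemma ideal_sum: "(\<And>s. s \<in> S \<Longrightarrow> f s \<in> I) \<Longrightarrow> sum f S \<in> I"
  by (induction S rule: infinite_finite_induct) (auto intro: ideal_zero ideal_add)

lemma cong_mult:
  assumes "a - a' \<in> I" "b - b' \<in> I" "b \<in> A" "a' \<in> A"
  shows "a * b - a' * b' \<in> I"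
proof -
  have "a * b - a' * b' = (a - a') * b + a' * (b - b')"
    by (simp add: algebra_simps)
  then show ?thesis
    using assms by (simp add: ideal_add ideal_mult ideal_mult_right)
qed

lemma cong_power:
  assumes "a - b \<in> I" "a \<in> A" "b \<in> A"
  shows "a ^ n - b ^ n \<in> I"
  using assms by (induction n) (auto intro: ideal_zero cong_mult power_closed)

lemma cong_prod:
  assumes "\<And>s. s \<in> S \<Longrightarrow> f s - g s \<in> I" "\<And>s. s \<in> S \<Longrightarrow> f s \<in> A" "\<And>s. s \<in> S \<Longrightarrow> g s \<in> A"
  shows "prod f S - prod g S \<in> I"
  using assms
  by (induction S rule: infinite_finite_induct) (auto intro!: ideal_zero cong_mult prod_closed)

lemma unit_not_in_ideal:
  assumes "1 \<notin> I" "a * a' - 1 \<in> I" "a' \<in> A"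
  shows "a \<notin> I"
proof
  assume "a \<in> I"
  then have "a * a' \<in> I"
    using assms(3) by (rule ideal_mult_right)
  then have "a * a' - (a * a' - 1) \<in> I"
    using assms(2) by (rule ideal_diff)
  moreover have "a * a' - (a * a' - 1) = 1"
    by (simp only: diff_diff_eq2 add_diff_cancel_left')
  ultimately show False
    using \<open>1 \<notin> I\<close> by (simp only:)
qed

end

context unital_subring
begin

lemma ideal_in_self: "ideal_in A A"
  by unfold_locales (auto intro: zero_closed diff_closed mult_closed)

lemmas sum_closed = ideal_in.ideal_sum[OF ideal_in_self]

end

definition finite_index :: "'d::idom set \<Rightarrow> 'd set \<Rightarrow> bool" where
  "finite_index A I \<longleftrightarrow> (\<exists>F. finite F \<and> F \<subseteq> A \<and> (\<forall>a\<in>A. \<exists>f\<in>F. a - f \<in> I))"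

text \<open>A choice function that is constant on cosets: its values stand for the elements of the finite
  residue ring \<open>A/I\<close>, so that no quotient type is needed.\<close>

lemma finite_index_representatives:
  assumes "ideal_in A I" "finite_index A I"
  obtains \<rho> where "finite (\<rho> ` A)" "\<rho> ` A \<subseteq> A" "\<And>a. a \<in> A \<Longrightarrow> a - \<rho> a \<in> I"
    "\<And>a b. a \<in> A \<Longrightarrow> b \<in> A \<Longrightarrow> a - b \<in> I \<Longrightarrow> \<rho> a = \<rho> b"
proof -
  interpret ideal_in A I by fact
  obtain F where F: "finite F" "F \<subseteq> A" "\<And>a. a \<in> A \<Longrightarrow> \<exists>f\<in>F. a - f \<in> I"
    using assms unfolding finite_index_def by blast
  define \<rho> where "\<rho> a = (SOME f. f \<in> F \<and> a - f \<in> I)" for a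
  have \<rho>: "\<rho> a \<in> F \<and> a - \<rho> a \<in> I" if "a \<in> A" for a
    unfolding \<rho>_def by (rule someI_ex) (use F(3)[OF that] in blast)
  have "\<rho> a = \<rho> b" if "a - b \<in> I" for a b
  proof -
    have "a - f \<in> I \<longleftrightarrow> b - f \<in> I" for f
      using ideal_add[OF that, of "b - f"] ideal_diff[OF _ that, of "a - f"] by auto
    then show ?thesis
      by (simp add: \<rho>_def)
  qed
  moreover have "finite (\<rho> ` A)" "\<rho> ` A \<subseteq> A"
    using \<rho> F(1,2) by (auto intro: finite_subset[of _ F])
  ultimately show thesis
    using \<rho> that by blast
qed

text \<open>This strengthening of residual finiteness, in which a nonzero element becomes invertible and not
  merely nonzero in a finite nonzero quotient, is what survives the adjunction of one algebraic
  element: there the leading coefficient of an equation has to be inverted.\<close>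

definition unit_mod_finite :: "'d::idom set \<Rightarrow> bool" where
  "unit_mod_finite A \<longleftrightarrow> unital_subring A \<and>
     (\<forall>a\<in>A. a \<noteq> 0 \<longrightarrow>
       (\<exists>I. ideal_in A I \<and> 1 \<notin> I \<and> finite_index A I \<and> (\<exists>a'\<in>A. a * a' - 1 \<in> I)))"

section \<open>Polynomials over a subring\<close>

definition polys_over :: "'d::idom set \<Rightarrow> 'd poly set" where
  "polys_over S = {p. \<forall>i. coeff p i \<in> S}"

definition adjoin :: "'d::idom set \<Rightarrow> 'd \<Rightarrow> 'd set" where
  "adjoin A x = {poly p x | p. p \<in> polys_over A}"

lemma adjoinI: "p \<in> polys_over A \<Longrightarrow> y = poly p x \<Longrightarrow> y \<in> adjoin A x"
  unfolding adjoin_def by blast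

context ideal_in
begin

lemma polys_over_zero: "0 \<in> polys_over I"
  by (simp add: polys_over_def ideal_zero)

lemma polys_over_diff: "p \<in> polys_over I \<Longrightarrow> q \<in> polys_over I \<Longrightarrow> p - q \<in> polys_over I"
  by (simp add: polys_over_def ideal_diff)

lemma polys_over_add: "p \<in> polys_over I \<Longrightarrow> q \<in> polys_over I \<Longrightarrow> p + q \<in> polys_over I"
  by (simp add: polys_over_def ideal_add)

lemma polys_over_mult: "p \<in> polys_over A \<Longrightarrow> q \<in> polys_over I \<Longrightarrow> p * q \<in> polys_over I"
  by (auto simp: polys_over_def coeff_mult intro!: ideal_sum ideal_mult)

lemma polys_over_smult: "a \<in> A \<Longrightarrow> q \<in> polys_over I \<Longrightarrow> smult a q \<in> polys_over I"
  by (auto simp: polys_over_def intro!: ideal_mult)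

lemma polys_over_smult_ideal: "a \<in> I \<Longrightarrow> q \<in> polys_over A \<Longrightarrow> smult a q \<in> polys_over I"
  by (auto simp: polys_over_def intro!: ideal_mult_right)

lemma polys_over_monom: "a \<in> I \<Longrightarrow> monom a n \<in> polys_over I"
  by (auto simp: polys_over_def ideal_zero)

lemma polys_over_subset: "polys_over I \<subseteq> polys_over A"
  using subset by (auto simp: polys_over_def)

text \<open>Division with remainder after multiplication by a power of the leading coefficient of the
  divisor.  Quotient and remainder inherit membership in the ideal of coefficients of the dividend;
  this is what shows that \<open>I\<close> does not blow up to the unit ideal when an algebraic element is
  adjoined.\<close>

lemma pseudo_division:
  assumes s: "s \<in> polys_over A" "0 < degree s" and g: "g \<in> polys_over I"
  shows "\<exists>k q r. smult (lead_coeff s ^ k) g = s * q + r \<and> q \<in> polys_over I \<and> r \<in> polys_over I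
      \<and> degree r < degree s"
  using g
proof (induction "degree g" arbitrary: g rule: less_induct)
  case less
  define c where "c = lead_coeff s"
  have c: "c \<in> A"
    using s by (simp add: c_def polys_over_def)
  show ?case
  proof (cases "degree g < degree s")
    case True
    then show ?thesis
      using less.prems polys_over_zero by (intro exI[of _ 0] exI[of _ 0] exI[of _ g]) auto
  next
    case False
    define m where "m = monom (lead_coeff g) (degree g - degree s)"
    have m: "m \<in> polys_over I"
      unfolding m_def using less.prems by (intro polys_over_monom) (simp add: polys_over_def)
    have sm: "s * m \<in> polys_over I"
      using s m by (intro polys_over_mult)
    define h where "h = smult c g - s * m"
    have h: "h \<in> polys_over I"
      unfolding h_def using c less.prems sm by (intro polys_over_diff polys_over_smult)
    have "degree (s * m) \<le> degree g"
      using degree_mult_le[of s m] False degree_monom_le[of "lead_coeff g" "degree g - degree s"]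
      unfolding m_def by linarith
    then have "degree h \<le> degree g"
      unfolding h_def by (intro degree_diff_le) (auto intro: order.trans[OF degree_smult_le])
    moreover have "coeff h (degree g) = 0"
      using False unfolding h_def m_def c_def
      by (subst mult.commute) (simp add: coeff_monom_mult)
    ultimately have "degree h < degree g"
      using False s(2)
      by (metis bot_nat_0.not_eq_extremum le_neq_implies_less leading_coeff_0_iff degree_0 not_less)
    then obtain k q r where *: "smult (c ^ k) h = s * q + r" "q \<in> polys_over I"
      "r \<in> polys_over I" "degree r < degree s"
      using less.hyps[OF _ h] unfolding c_def by blast
    have "smult (c ^ Suc k) g = smult (c ^ k) h + s * smult (c ^ k) m"
      by (simp add: h_def smult_diff_right mult.commute)
    also have "\<dots> = s * (q + smult (c ^ k) m) + r"
      by (simp add: * algebra_simps)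
    finally show ?thesis
      using * m c unfolding c_def[symmetric]
      by (intro exI[of _ "Suc k"] exI[of _ "q + smult (c ^ k) m"] exI[of _ r])
         (auto intro!: polys_over_add polys_over_smult power_closed)
  qed
qed

end

lemma (in unital_subring) unital_subring_adjoin: "unital_subring (adjoin A x)"
proof -
  interpret self: ideal_in A A by (rule ideal_in_self)
  show ?thesis
  proof
    show "1 \<in> adjoin A x"
      unfolding adjoin_def
      by (auto intro!: exI[of _ 1] simp: polys_over_def one_closed zero_closed)
  next
    fix a b assume "a \<in> adjoin A x" "b \<in> adjoin A x"
    then show "a - b \<in> adjoin A x" "a * b \<in> adjoin A x"
      unfolding adjoin_def
      by (auto intro: self.polys_over_diff self.polys_over_mult
          simp flip: poly_diff poly_mult)
  qed
qed

lemma (in unital_subring) subset_adjoin: "A \<subseteq> adjoin A x"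
proof
  fix a assume "a \<in> A"
  then show "a \<in> adjoin A x"
    unfolding adjoin_def polys_over_def
    by (auto intro!: exI[of _ "[:a:]"] simp: zero_closed coeff_pCons split: nat.split)
qed

lemma (in unital_subring) generator_in_adjoin: "x \<in> adjoin A x"
  unfolding adjoin_def polys_over_def
  by (auto intro!: exI[of _ "[:0, 1:]"] simp: zero_closed one_closed coeff_pCons split: nat.split)

text \<open>The ideal of \<open>A[x]\<close> generated by \<open>I\<close> and \<open>f(x)\<close>.  It serves both kinds of extension: for algebraic
  \<open>x\<close> the polynomial \<open>f\<close> is an equation for \<open>x\<close>, so that it adds nothing to \<open>I A[x]\<close>, and for
  transcendental \<open>x\<close> it is imposed as a new relation.\<close>

definition ideal_adjoin :: "'d::idom set \<Rightarrow> 'd set \<Rightarrow> 'd poly \<Rightarrow> 'd \<Rightarrow> 'd set" where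
  "ideal_adjoin A I f x = {poly (i + f * q) x | i q. i \<in> polys_over I \<and> q \<in> polys_over A}"

lemma ideal_adjoinI:
  "i \<in> polys_over I \<Longrightarrow> q \<in> polys_over A \<Longrightarrow> y = poly (i + f * q) x \<Longrightarrow> y \<in> ideal_adjoin A I f x"
  unfolding ideal_adjoin_def by blast

context ideal_in
begin

lemma ideal_in_ideal_adjoin:
  assumes f: "f \<in> polys_over A"
  shows "ideal_in (adjoin A x) (ideal_adjoin A I f x)"
proof -
  interpret self: ideal_in A A by (rule ideal_in_self)
  interpret B: unital_subring "adjoin A x" by (rule unital_subring_adjoin)
  show ?thesis
  proof
    show "ideal_adjoin A I f x \<subseteq> adjoin A x"
      unfolding ideal_adjoin_def adjoin_def using f polys_over_subset
      by (blast intro: self.polys_over_add self.polys_over_mult)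
    show "0 \<in> ideal_adjoin A I f x"
      unfolding ideal_adjoin_def using polys_over_zero self.polys_over_zero
      by (force intro: exI[of _ 0])
  next
    fix a b assume "a \<in> ideal_adjoin A I f x" "b \<in> ideal_adjoin A I f x"
    then obtain i q j r where *: "a = poly (i + f * q) x" "b = poly (j + f * r) x"
      "i \<in> polys_over I" "q \<in> polys_over A" "j \<in> polys_over I" "r \<in> polys_over A"
      unfolding ideal_adjoin_def by blast
    have "a - b = poly ((i - j) + f * (q - r)) x"
      by (simp add: * algebra_simps)
    then show "a - b \<in> ideal_adjoin A I f x"
      unfolding ideal_adjoin_def using * polys_over_diff self.polys_over_diff by blast
  next
    fix a b assume "a \<in> adjoin A x" "b \<in> ideal_adjoin A I f x"
    then obtain i q p where *: "a = poly p x" "b = poly (i + f * q) x"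
      "i \<in> polys_over I" "q \<in> polys_over A" "p \<in> polys_over A"
      unfolding ideal_adjoin_def adjoin_def by blast
    have "a * b = poly (p * i + f * (p * q)) x"
      by (simp add: * algebra_simps)
    then show "a * b \<in> ideal_adjoin A I f x"
      unfolding ideal_adjoin_def using * polys_over_mult self.polys_over_mult by blast
  qed
qed

lemma ideal_subset_ideal_adjoin: "I \<subseteq> ideal_adjoin A I f x"
proof
  fix a assume "a \<in> I"
  then have "[:a:] \<in> polys_over I"
    by (simp add: polys_over_def coeff_pCons ideal_zero split: nat.split)
  then show "a \<in> ideal_adjoin A I f x"
    using ideal_in.polys_over_zero[OF ideal_in_self] by (rule ideal_adjoinI) simp
qed

text \<open>The leading coefficient of \<open>f\<close> is a unit modulo \<open>I\<close>, so division by \<open>f\<close> is possible modulo \<open>I\<close>,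
  and every element is congruent to a polynomial of degree less than \<open>degree f\<close> whose coefficients
  come from a finite set of representatives.\<close>

lemma finite_index_ideal_adjoin:
  assumes fin: "finite_index A I" and f: "f \<in> polys_over A" "0 < degree f"
    and unit: "a \<in> A" "lead_coeff f * a - 1 \<in> I"
  shows "finite_index (adjoin A x) (ideal_adjoin A I f x)"
proof -
  interpret self: ideal_in A A by (rule ideal_in_self)
  obtain F where F: "finite F" "F \<subseteq> A" and rep: "\<And>a. a \<in> A \<Longrightarrow> \<exists>f\<in>F. a - f \<in> I"
    using fin unfolding finite_index_def by blast
  obtain \<rho> where \<rho>: "\<And>a. a \<in> A \<Longrightarrow> \<rho> a \<in> F" "\<And>a. a \<in> A \<Longrightarrow> a - \<rho> a \<in> I"
    using rep by metis
  define d where "d = degree f"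
  define H where "H = (\<lambda>l. poly (Poly l) x) ` {l. set l \<subseteq> F \<and> length l = d}"
  have "finite H"
    unfolding H_def using F by (intro finite_imageI finite_lists_length_eq)
  moreover have "H \<subseteq> adjoin A x"
    unfolding H_def polys_over_def using F zero_closed
    by (force intro!: adjoinI[OF _ refl] simp: polys_over_def nth_default_def)
  moreover have "\<exists>h\<in>H. b - h \<in> ideal_adjoin A I f x" if b: "b \<in> adjoin A x" for b
  proof -
    obtain g where g: "g \<in> polys_over A" "b = poly g x"
      using b unfolding adjoin_def by blast
    define c where "c = lead_coeff f"
    have c: "c \<in> A"
      using f by (simp add: c_def polys_over_def)
    obtain k q r where *: "smult (c ^ k) g = f * q + r" "q \<in> polys_over A"
      "r \<in> polys_over A" "degree r < d"
      using self.pseudo_division[OF f g(1)] unfolding c_def d_def by blast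
    define r' where "r' = smult (a ^ k) r"
    have r': "r' \<in> polys_over A"
      unfolding r'_def using * unit by (intro self.polys_over_smult power_closed)
    then have coeff_r': "coeff r' i \<in> A" for i
      by (simp add: polys_over_def)
    define l where "l = map (\<lambda>i. \<rho> (coeff r' i)) [0..<d]"
    have "degree r' < d"
      unfolding r'_def using * degree_smult_le[of "a ^ k" r] by linarith
    then have "coeff (r' - Poly l) i \<in> I" for i
      using \<rho>(2)[OF coeff_r'] ideal_zero
      by (auto simp: l_def nth_default_def coeff_eq_0)
    then have 1: "r' - Poly l \<in> polys_over I"
      by (simp add: polys_over_def)
    \<comment> \<open>Multiplying the pseudo-division by \<open>a ^ k\<close> undoes the factor \<open>c ^ k\<close> modulo \<open>I\<close>.\<close>
    have "(c * a) ^ k - 1 ^ k \<in> I"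
      using unit c by (intro cong_power) (auto simp: c_def intro: mult_closed one_closed)
    then have 2: "smult ((c * a) ^ k - 1) g \<in> polys_over I"
      using g by (intro polys_over_smult_ideal) auto
    have "smult ((c * a) ^ k) g = smult (a ^ k) (smult (c ^ k) g)"
      by (simp add: power_mult_distrib mult.commute)
    also have "\<dots> = f * smult (a ^ k) q + r'"
      by (simp add: * r'_def smult_add_right)
    finally have "g - Poly l
        = (r' - Poly l - smult ((c * a) ^ k - 1) g) + f * smult (a ^ k) q"
      by (simp add: smult_diff_left)
    then have "b - poly (Poly l) x
        = poly ((r' - Poly l - smult ((c * a) ^ k - 1) g) + f * smult (a ^ k) q) x"
      unfolding g(2) by (simp only: flip: poly_diff)
    moreover have "r' - Poly l - smult ((c * a) ^ k - 1) g \<in> polys_over I"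
      using 1 2 by (rule polys_over_diff)
    moreover have "smult (a ^ k) q \<in> polys_over A"
      using * unit by (intro self.polys_over_smult power_closed)
    ultimately have "b - poly (Poly l) x \<in> ideal_adjoin A I f x"
      by (intro ideal_adjoinI)
    moreover have "poly (Poly l) x \<in> H"
      unfolding H_def
      by (rule imageI) (use \<rho>(1)[OF coeff_r'] in \<open>auto simp: l_def\<close>)
    ultimately show ?thesis by blast
  qed
  ultimately show ?thesis
    unfolding finite_index_def by blast
qed

end

section \<open>Finite quotients of finitely generated domains\<close>

context ideal_in
begin

text \<open>Over \<open>A/I\<close> a polynomial of positive degree whose leading coefficient is a unit does not divide
  \<open>1\<close>: the top coefficient of \<open>q\<close> outside \<open>I\<close> would survive, multiplied by a unit, in the product
  \<open>f q\<close>.\<close>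

lemma one_notin_ideal_adjoin_transcendental:
  assumes trans: "\<And>p. p \<in> polys_over A \<Longrightarrow> poly p x = 0 \<Longrightarrow> p = 0"
    and f: "f \<in> polys_over A" "0 < degree f"
    and unit: "a \<in> A" "lead_coeff f * a - 1 \<in> I" and proper: "1 \<notin> I"
  shows "1 \<notin> ideal_adjoin A I f x"
proof
  interpret self: ideal_in A A by (rule ideal_in_self)
  assume "1 \<in> ideal_adjoin A I f x"
  then obtain i q where i: "i \<in> polys_over I" and q: "q \<in> polys_over A"
    and 1: "poly (i + f * q) x = 1"
    unfolding ideal_adjoin_def by auto
  have "1 - (i + f * q) \<in> polys_over A"
    using polys_over_subset i q f one_closed zero_closed
    by (intro self.polys_over_diff self.polys_over_add self.polys_over_mult)
       (auto simp: polys_over_def)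
  then have "1 - (i + f * q) = 0"
    by (rule trans) (use 1 in simp)
  then have eq: "f * q = 1 - i" by (simp add: algebra_simps)
  have "\<exists>m. coeff q m \<notin> I"
  proof (rule ccontr)
    assume "\<not> ?thesis"
    then have "i + f * q \<in> polys_over I"
      using i f by (intro polys_over_add polys_over_mult) (auto simp: polys_over_def)
    then have "coeff (i + f * q) 0 \<in> I"
      unfolding polys_over_def by blast
    then show False
      using proper by (simp only: eq) simp
  qed
  moreover have "finite {m. coeff q m \<notin> I}"
  proof (rule finite_subset)
    show "{m. coeff q m \<notin> I} \<subseteq> {..degree q}"
      using ideal_zero le_degree[of q] by (metis atMost_iff mem_Collect_eq subsetI)
  qed simp
  ultimately obtain m where m: "coeff q m \<notin> I" and max: "\<And>j. m < j \<Longrightarrow> coeff q j \<in> I"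
    using Max_in[of "{m. coeff q m \<notin> I}"] Max_ge[of "{m. coeff q m \<notin> I}"]
    by (metis (no_types, lifting) empty_Collect_eq mem_Collect_eq not_less)
  define n where "n = degree f"
  let ?t = "\<lambda>j. coeff f j * coeff q (n + m - j)"
  have "?t j \<in> I" if "j \<in> {..n + m} - {n}" for j
  proof (cases "j < n")
    case True
    then show ?thesis
      using f max by (intro ideal_mult) (auto simp: polys_over_def)
  next
    case False
    then show ?thesis
      using that by (simp add: n_def coeff_eq_0 ideal_zero)
  qed
  then have "sum ?t ({..n + m} - {n}) \<in> I"
    by (rule ideal_sum)
  moreover have "coeff i (n + m) \<in> I"
    using i by (simp add: polys_over_def)
  ultimately have "0 - coeff i (n + m) - sum ?t ({..n + m} - {n}) \<in> I"
    by (intro ideal_diff ideal_zero)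
  moreover have "?t n + sum ?t ({..n + m} - {n}) = coeff (f * q) (n + m)"
    unfolding coeff_mult by (subst (2) sum.remove[of _ n]) auto
  then have "?t n + sum ?t ({..n + m} - {n}) = 0 - coeff i (n + m)"
    using f(2) by (simp add: eq n_def)
  then have "?t n = 0 - coeff i (n + m) - sum ?t ({..n + m} - {n})"
    by (simp only: eq_diff_eq)
  ultimately have lead: "lead_coeff f * coeff q m \<in> I"
    by (simp add: n_def)
  have qm: "coeff q m \<in> A"
    using q by (simp add: polys_over_def)
  have "a * (lead_coeff f * coeff q m) - (lead_coeff f * a - 1) * coeff q m \<in> I"
    by (rule ideal_diff[OF ideal_mult[OF unit(1) lead] ideal_mult_right[OF unit(2) qm]])
  then show False
    using m by (simp add: algebra_simps)
qed

text \<open>If \<open>1\<close> were a value at \<open>x\<close> of a polynomial with coefficients in \<open>I\<close>, then pseudo-division by \<open>f\<close>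
  would make a power of the leading coefficient \<open>c\<close> a value of such a polynomial of degree less than
  \<open>degree f\<close>.  As no nonzero polynomial of so small a degree vanishes at \<open>x\<close>, comparing constant
  coefficients puts that power into \<open>I\<close>, although \<open>c\<close> is a unit modulo \<open>I\<close>.\<close>

lemma one_notin_ideal_adjoin_algebraic:
  assumes f: "f \<in> polys_over A" "0 < degree f" "poly f x = 0"
    and least: "\<And>p. p \<in> polys_over A \<Longrightarrow> poly p x = 0 \<Longrightarrow> degree p < degree f \<Longrightarrow> p = 0"
    and unit: "a \<in> A" "lead_coeff f * a - 1 \<in> I" and proper: "1 \<notin> I"
  shows "1 \<notin> ideal_adjoin A I f x"
proof
  interpret self: ideal_in A A by (rule ideal_in_self)
  define c where "c = lead_coeff f"
  have c: "c \<in> A"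
    using f by (simp add: c_def polys_over_def)
  assume "1 \<in> ideal_adjoin A I f x"
  then obtain i where i: "i \<in> polys_over I" and 1: "poly i x = 1"
    unfolding ideal_adjoin_def using f(3) by auto
  obtain k q r where *: "smult (c ^ k) i = f * q + r" "r \<in> polys_over I" "degree r < degree f"
    using pseudo_division[OF f(1,2) i] unfolding c_def by blast
  have "poly r x = c ^ k"
    using arg_cong[OF *(1), of "\<lambda>p. poly p x"] by (simp add: 1 f(3))
  then have "r - [:c ^ k:] = 0"
    using * c polys_over_subset power_closed[OF c] zero_closed f(2)
    by (intro least self.polys_over_diff degree_diff_less)
       (auto simp: polys_over_def coeff_pCons split: nat.split)
  then have "coeff r 0 = c ^ k" by simp
  moreover have "coeff r 0 \<in> I"
    using *(2) by (simp add: polys_over_def)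
  ultimately have "c ^ k \<in> I" by simp
  moreover have "c ^ k * a ^ k - 1 \<in> I"
    using cong_power[of "c * a" 1 k] unit c one_closed mult_closed
    by (simp add: c_def power_mult_distrib)
  ultimately show False
    using unit_not_in_ideal proper power_closed[OF unit(1)] by blast
qed

end

text \<open>Every nonzero element of an algebraic extension divides a nonzero element of the base ring, so
  making the latter invertible makes the former invertible.  The multiple is found without resultants: a
  nonzero multiple \<open>s(x)\<close> of \<open>b\<close> with \<open>degree s\<close> least has \<open>degree s = 0\<close>.\<close>

lemma (in unital_subring) nonzero_multiple_in_subring:
  assumes f: "f \<in> polys_over A" "0 < degree f" "poly f x = 0"
    and least: "\<And>p. p \<in> polys_over A \<Longrightarrow> poly p x = 0 \<Longrightarrow> degree p < degree f \<Longrightarrow> p = 0"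
    and b: "b \<in> adjoin A x" "b \<noteq> 0"
  obtains b' where "b' \<in> adjoin A x" "b * b' \<in> A" "b * b' \<noteq> 0"
proof -
  interpret self: ideal_in A A by (rule ideal_in_self)
  interpret B: unital_subring "adjoin A x" by (rule unital_subring_adjoin)
  have lead: "lead_coeff p \<in> A" if "p \<in> polys_over A" for p
    using that by (simp add: polys_over_def)
  have val: "poly p x \<in> adjoin A x" if "p \<in> polys_over A" for p
    using that unfolding adjoin_def by blast
  define S where "S s \<longleftrightarrow> s \<in> polys_over A \<and> poly s x \<noteq> 0 \<and> (\<exists>y\<in>adjoin A x. poly s x = b * y)"
    for s
  have "\<exists>s. S s"
    using b B.one_closed unfolding S_def by (subst (asm) adjoin_def) force
  then obtain s where s: "S s" and s_least: "\<And>t. S t \<Longrightarrow> degree s \<le> degree t"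
    using ex_has_least_nat[of S _ degree] by blast
  then obtain y where y: "s \<in> polys_over A" "poly s x \<noteq> 0" "y \<in> adjoin A x" "poly s x = b * y"
    unfolding S_def by blast
  have "degree s = 0"
  proof (rule ccontr)
    assume pos: "degree s \<noteq> 0"
    \<comment> \<open>Otherwise the remainder of \<open>s\<close> modulo \<open>f\<close> would be a better choice.\<close>
    have less: "degree s < degree f"
    proof (rule ccontr)
      assume not_less: "\<not> degree s < degree f"
      obtain k q r where *: "smult (lead_coeff f ^ k) s = f * q + r"
        "r \<in> polys_over A" "degree r < degree f"
        using self.pseudo_division[OF f(1,2) y(1)] by blast
      have "poly r x = lead_coeff f ^ k * poly s x"
        using arg_cong[OF *(1), of "\<lambda>p. poly p x"] by (simp add: f(3))
      then have "poly r x \<noteq> 0" "poly r x = b * (lead_coeff f ^ k * y)"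
        using y f(2) by auto
      moreover have "lead_coeff f ^ k * y \<in> adjoin A x"
        using y lead[OF f(1)] subset_adjoin by (intro B.mult_closed B.power_closed) auto
      ultimately have "S r"
        using * unfolding S_def by blast
      then have "degree s \<le> degree r"
        by (rule s_least)
      then show False
        using * not_less by linarith
    qed
    \<comment> \<open>The remainder of \<open>f\<close> modulo \<open>s\<close> has too small a degree, so it is zero, and then \<open>q\<close> is an
      equation for \<open>x\<close> of degree less than \<open>degree f\<close>.\<close>
    obtain k q r where *: "smult (lead_coeff s ^ k) f = s * q + r"
      "q \<in> polys_over A" "r \<in> polys_over A" "degree r < degree s"
      using self.pseudo_division[of s f] f y(1) pos by blast
    have sum: "poly s x * poly q x + poly r x = 0"
      using arg_cong[OF *(1), of "\<lambda>p. poly p x"] by (simp add: f(3))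
    have "poly r x = 0"
    proof (rule ccontr)
      assume "poly r x \<noteq> 0"
      moreover have "poly r x = b * (0 - y * poly q x)"
        using sum y(4) by (simp add: eq_neg_iff_add_eq_0 add.commute mult.assoc)
      moreover have "0 - y * poly q x \<in> adjoin A x"
        using y val[OF *(2)] by (intro B.diff_closed B.zero_closed B.mult_closed)
      ultimately have "S r"
        using * unfolding S_def by blast
      then show False
        using s_least[of r] * by linarith
    qed
    then have "r = 0" "poly q x = 0"
      using sum y(2) * less by (auto intro!: least)
    have "s \<noteq> 0" "f \<noteq> 0"
      using pos f(2) by auto
    then have "q \<noteq> 0"
      using *(1) \<open>r = 0\<close> by auto
    have "degree f = degree s + degree q"
      using arg_cong[OF *(1), of degree] \<open>r = 0\<close> \<open>s \<noteq> 0\<close> \<open>q \<noteq> 0\<close>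
      by (simp add: degree_mult_eq)
    then show False
      using least[OF *(2) \<open>poly q x = 0\<close>] pos \<open>q \<noteq> 0\<close> by simp
  qed
  then have "poly s x = coeff s 0"
    by (metis degree_eq_zeroE mult_zero_right pCons_0_0 poly_pCons add_0_right coeff_pCons_0 poly_0)
  then show thesis
    using that[of y] y by (simp add: polys_over_def)
qed

text \<open>For transcendental \<open>x\<close> and \<open>b = p(x)\<close> the relation \<open>1 + x p(x) = 0\<close> is imposed, which forces \<open>-x\<close> to
  be an inverse of \<open>b\<close>; the polynomial \<open>1 + X p\<close> has the leading coefficient of \<open>p\<close>, which can be made a unit modulo \<open>I\<close>.
  For algebraic \<open>x\<close> with an equation \<open>f\<close> of least degree, \<open>I\<close> is chosen such that both the leading
  coefficient of \<open>f\<close> and a nonzero multiple of \<open>b\<close> in \<open>A\<close> are units modulo \<open>I\<close>.\<close>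

lemma unit_mod_finite_adjoin:
  assumes A: "unit_mod_finite A"
  shows "unit_mod_finite (adjoin A x)"
proof -
  interpret unital_subring A
    using A unfolding unit_mod_finite_def by blast
  interpret self: ideal_in A A by (rule ideal_in_self)
  interpret B: unital_subring "adjoin A x" by (rule unital_subring_adjoin)
  have ex: "\<exists>I. ideal_in A I \<and> 1 \<notin> I \<and> finite_index A I \<and> (\<exists>a'\<in>A. a * a' - 1 \<in> I)"
    if "a \<in> A" "a \<noteq> 0" for a
    using A that unfolding unit_mod_finite_def by blast
  have "\<exists>J. ideal_in (adjoin A x) J \<and> 1 \<notin> J \<and> finite_index (adjoin A x) J
      \<and> (\<exists>b'\<in>adjoin A x. b * b' - 1 \<in> J)" if b: "b \<in> adjoin A x" "b \<noteq> 0" for b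
  proof (cases "\<exists>p\<in>polys_over A. poly p x = 0 \<and> p \<noteq> 0")
    case False
    obtain p where p: "p \<in> polys_over A" "b = poly p x"
      using b unfolding adjoin_def by blast
    have "p \<noteq> 0" using b p by auto
    obtain I a' where I: "ideal_in A I" "1 \<notin> I" "finite_index A I"
      and a': "a' \<in> A" "lead_coeff p * a' - 1 \<in> I"
      using ex[of "lead_coeff p"] p \<open>p \<noteq> 0\<close> by (auto simp: polys_over_def)
    interpret ideal_in A I by fact
    define f where "f = pCons 1 p"
    have f: "f \<in> polys_over A" "0 < degree f" "lead_coeff f = lead_coeff p"
      using p \<open>p \<noteq> 0\<close> one_closed
      by (auto simp: f_def polys_over_def coeff_pCons split: nat.split)
    have "poly f x \<in> ideal_adjoin A I f x"
      using polys_over_zero one_closed zero_closed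
      by (intro ideal_adjoinI[of 0 _ 1]) (auto simp: polys_over_def)
    then have "0 - poly f x \<in> ideal_adjoin A I f x"
      using ideal_in_ideal_adjoin[OF f(1)]
      by (meson ideal_in.ideal_diff ideal_in.ideal_zero)
    moreover have "0 - poly f x = b * (0 - x) - 1"
      by (simp add: f_def p algebra_simps)
    ultimately have "b * (0 - x) - 1 \<in> ideal_adjoin A I f x"
      by simp
    then show ?thesis
      using ideal_in_ideal_adjoin[OF f(1), of x] finite_index_ideal_adjoin[of f a' x]
        one_notin_ideal_adjoin_transcendental[of x f a'] I a' f False
        B.diff_closed[OF B.zero_closed generator_in_adjoin]
      by (intro exI[of _ "ideal_adjoin A I f x"] conjI bexI[of _ "0 - x"]) auto
  next
    case True
    then obtain f where f: "f \<in> polys_over A" "poly f x = 0" "f \<noteq> 0"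
      and le: "\<And>p. p \<in> polys_over A \<Longrightarrow> poly p x = 0 \<Longrightarrow> p \<noteq> 0 \<Longrightarrow> degree f \<le> degree p"
      using ex_has_least_nat[of "\<lambda>p. p \<in> polys_over A \<and> poly p x = 0 \<and> p \<noteq> 0" _ degree] by blast
    have least: "\<And>p. p \<in> polys_over A \<Longrightarrow> poly p x = 0 \<Longrightarrow> degree p < degree f \<Longrightarrow> p = 0"
      using le not_less by blast
    have pos: "0 < degree f"
      using f(2,3) by (metis degree_eq_zeroE gr0I mult_zero_right pCons_0_0 poly_pCons add_0_right poly_0)
    obtain b' where b': "b' \<in> adjoin A x" "b * b' \<in> A" "b * b' \<noteq> 0"
      using nonzero_multiple_in_subring[OF f(1) pos f(2) least b] by blast
    have lead: "lead_coeff f \<in> A" "lead_coeff f \<noteq> 0"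
      using f by (auto simp: polys_over_def)
    obtain I a' where I: "ideal_in A I" "1 \<notin> I" "finite_index A I"
      and a': "a' \<in> A" "(lead_coeff f * (b * b')) * a' - 1 \<in> I"
      using ex[of "lead_coeff f * (b * b')"] lead b' mult_closed by auto
    interpret ideal_in A I by fact
    have unit: "b * b' * a' \<in> A" "lead_coeff f * (b * b' * a') - 1 \<in> I"
      using a' mult_closed[OF b'(2) a'(1)] by (simp_all only: mult.assoc)
    have "b * (b' * (lead_coeff f * a')) - 1 \<in> ideal_adjoin A I f x"
      using unit ideal_subset_ideal_adjoin[of f x] by (auto simp: ac_simps)
    moreover have "b' * (lead_coeff f * a') \<in> adjoin A x"
      using b' a' lead subset_adjoin by (intro B.mult_closed) auto
    ultimately show ?thesis
      using ideal_in_ideal_adjoin[OF f(1)] finite_index_ideal_adjoin[OF I(3) f(1) pos unit]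
        one_notin_ideal_adjoin_algebraic[OF f(1) pos f(2) least unit I(2)]
      by blast
  qed
  then show ?thesis
    unfolding unit_mod_finite_def using unital_subring_adjoin by blast
qed

text \<open>Both characteristics are treated alike by means of a prime \<open>p\<close> that does not divide \<open>n\<close> and such that
  \<open>p\<close> is not invertible in the prime ring.  In positive characteristic \<open>p\<close> is the characteristic
  and the ideal \<open>I\<close> generated by \<open>p\<close> is zero.\<close>

lemma unit_mod_finite_integers: "unit_mod_finite (range of_int :: 'd::idom set)"
proof -
  let ?Z = "range of_int :: 'd set"
  interpret unital_subring ?Z
  proof
    show "1 \<in> ?Z"
      by (metis of_int_1 rangeI)
  qed (auto simp flip: of_int_diff of_int_mult)
  have "\<exists>I. ideal_in ?Z I \<and> 1 \<notin> I \<and> finite_index ?Z I \<and> (\<exists>a'\<in>?Z. a * a' - 1 \<in> I)"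
    if a: "a \<in> ?Z" "a \<noteq> 0" for a
  proof -
    obtain n where n: "a = of_int n"
      using a(1) by auto
    have "n \<noteq> 0"
      using a(2) n by auto
    obtain p :: nat where p: "prime p" "\<not> int p dvd n" "\<And>m. of_int (int p * m) \<noteq> (1::'d)"
    proof (cases "CHAR('d) = 0")
      case True
      obtain p where p: "prime p" "nat \<bar>n\<bar> < p"
        using bigger_prime by blast
      then have "\<not> int p dvd n"
        using \<open>n \<noteq> 0\<close> zdvd_imp_le[of "int p" "\<bar>n\<bar>"] by auto
      moreover have "of_int (int p * m) \<noteq> (1::'d)" for m
      proof
        assume "of_int (int p * m) = (1::'d)"
        then have "of_int (int p * m - 1) = (0::'d)" by simp
        then have "int p * m = 1"
          using True by (simp only: of_int_eq_0_iff_char_dvd) simp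
        then have "int p dvd 1"
          by (metis dvd_triv_left)
        then show False
          using p(1) by simp
      qed
      ultimately show ?thesis
        by (rule that[OF p(1)])
    next
      case False
      then have "prime CHAR('d)" "\<not> int CHAR('d) dvd n"
        using prime_CHAR_semidom[where 'a = 'd] a n by (auto simp: of_int_eq_0_iff_char_dvd)
      then show ?thesis
        by (rule that) simp
    qed
    define I where "I = range (\<lambda>m. of_int (int p * m) :: 'd)"
    have I: "of_int (int p * m) \<in> I" for m
      unfolding I_def by blast
    have "ideal_in ?Z I"
    proof
      show "I \<subseteq> ?Z"
        unfolding I_def by blast
      show "0 \<in> I" using I[of 0] by simp
    next
      fix a b assume "a \<in> I" "b \<in> I"
      then show "a - b \<in> I"
        using I unfolding I_def by (auto simp flip: of_int_diff right_diff_distrib)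
    next
      fix a b assume "a \<in> ?Z" "b \<in> I"
      then obtain k m where "a = of_int k" "b = of_int (int p * m)"
        unfolding I_def by auto
      then have "a * b = of_int (int p * (k * m))" by simp
      then show "a * b \<in> I" using I by metis
    qed
    moreover have "1 \<notin> I"
      using p(3) unfolding I_def by (metis rangeE)
    moreover have "finite_index ?Z I"
      unfolding finite_index_def
    proof (intro exI[of _ "of_int ` {0..<int p}"] conjI ballI)
      fix a assume "a \<in> ?Z"
      then obtain k where "a = of_int k" by auto
      then have "a - of_int (k mod int p) = of_int (int p * (k div int p))"
        by (simp only: minus_mod_eq_mult_div flip: of_int_diff)
      moreover have "k mod int p \<in> {0..<int p}"
        using p(1) by (simp add: prime_gt_0_nat)
      ultimately show "\<exists>f\<in>of_int ` {0..<int p}. a - f \<in> I"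
        using I by (metis imageI)
    qed auto
    moreover have "\<exists>a'\<in>?Z. a * a' - 1 \<in> I"
    proof -
      have "coprime (int p) n"
        using p by (intro prime_imp_coprime) auto
      then obtain u v where "u * int p + v * n = 1"
        using bezout_int[of "int p" n] by auto
      then have "n * v - 1 = int p * (- u)"
        by (simp add: algebra_simps)
      then have "a * of_int v - 1 = of_int (int p * (- u))"
        unfolding n by (metis of_int_1 of_int_diff of_int_mult)
      then show ?thesis
        using I by (metis rangeI)
    qed
    ultimately show ?thesis by blast
  qed
  then show ?thesis
    unfolding unit_mod_finite_def using unital_subring_axioms by blast
qed

lemma finite_subset_unit_mod_finite:
  assumes "finite C"
  obtains R :: "'d::idom set" where "C \<subseteq> R" "unit_mod_finite R"
proof -
  from assms have "\<exists>R. C \<subseteq> R \<and> unit_mod_finite R"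
  proof induction
    case empty
    then show ?case using unit_mod_finite_integers by blast
  next
    case (insert x C)
    then obtain R where R: "C \<subseteq> R" "unit_mod_finite R" by blast
    then have "unital_subring R"
      unfolding unit_mod_finite_def by blast
    then show ?case
      using R unit_mod_finite_adjoin[of R x] unital_subring.subset_adjoin[of R x]
        unital_subring.generator_in_adjoin[of R x]
      by (intro exI[of _ "adjoin R x"]) auto
  qed
  then show thesis using that by blast
qed

section \<open>Evaluation of elements of the near ring\<close>

text \<open>Values are taken in \<open>k[T]\<close>, which has the room that a finite field lacks; coefficients are
  constant polynomials there.\<close>

definition eval_exponent :: "('a \<Rightarrow> 'r::comm_monoid_mult) \<Rightarrow> ('a \<Rightarrow>\<^sub>0 nat) \<Rightarrow> 'r" where
  "eval_exponent v u = (\<Prod>g\<in>Poly_Mapping.keys u. v g ^ Poly_Mapping.lookup u g)"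

definition evaluate :: "(('a \<Rightarrow>\<^sub>0 nat) \<Rightarrow>\<^sub>0 'k::field) \<Rightarrow> ('a \<Rightarrow> 'k poly) \<Rightarrow> 'k poly" where
  "evaluate \<gamma> v = (\<Sum>u\<in>Poly_Mapping.keys \<gamma>. [:Poly_Mapping.lookup \<gamma> u:] * eval_exponent v u)"

lemma eval_exponent_superset:
  assumes "finite S" "Poly_Mapping.keys u \<subseteq> S"
  shows "eval_exponent v u = (\<Prod>g\<in>S. v g ^ Poly_Mapping.lookup u g)"
  unfolding eval_exponent_def
  using assms by (intro prod.mono_neutral_left) (auto simp: in_keys_iff)

lemma evaluate_superset:
  assumes "finite S" "Poly_Mapping.keys \<gamma> \<subseteq> S"
  shows "evaluate \<gamma> v = (\<Sum>u\<in>S. [:Poly_Mapping.lookup \<gamma> u:] * eval_exponent v u)"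
  unfolding evaluate_def
  using assms by (intro sum.mono_neutral_left) (auto simp: in_keys_iff)

lemma eval_exponent_zero [simp]: "eval_exponent v 0 = 1"
  by (simp add: eval_exponent_def)

lemma eval_exponent_add: "eval_exponent v (u + w) = eval_exponent v u * eval_exponent v w"
proof -
  let ?S = "Poly_Mapping.keys u \<union> Poly_Mapping.keys w"
  have "Poly_Mapping.keys (u + w) \<subseteq> ?S"
    by (rule Poly_Mapping.keys_add)
  then show ?thesis
    by (simp add: eval_exponent_superset[of ?S] lookup_add power_add prod.distrib)
qed

lemma evaluate_zero [simp]: "evaluate 0 v = 0"
  by (simp add: evaluate_def)

lemma evaluate_single: "evaluate (Poly_Mapping.single u c) v = [:c:] * eval_exponent v u"
  by (simp add: evaluate_superset[of "{u}"])

lemma evaluate_add: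
  fixes \<gamma> \<delta> :: "('a \<Rightarrow>\<^sub>0 nat) \<Rightarrow>\<^sub>0 'k::field"
  shows "evaluate (\<gamma> + \<delta>) v = evaluate \<gamma> v + evaluate \<delta> v"
proof -
  let ?S = "Poly_Mapping.keys \<gamma> \<union> Poly_Mapping.keys \<delta>"
  have "Poly_Mapping.keys (\<gamma> + \<delta>) \<subseteq> ?S"
    by (rule Poly_Mapping.keys_add)
  moreover have "[:a + b:] * p = [:a:] * p + [:b:] * p" for a b :: 'k and p
    by (simp add: smult_add_left)
  ultimately show ?thesis
    by (simp only: evaluate_superset[of ?S] lookup_add sum.distrib finite_UnI finite_keys
        Un_upper1 Un_upper2)
qed

lemma evaluate_diff: "evaluate (\<gamma> - \<delta>) v = evaluate \<gamma> v - evaluate \<delta> v"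
  using evaluate_add[of "\<gamma> - \<delta>" \<delta> v] by simp

lemma evaluate_sum: "evaluate (\<Sum>i\<in>S. f i) v = (\<Sum>i\<in>S. evaluate (f i) v)"
  by (induction S rule: infinite_finite_induct) (simp_all add: evaluate_add)

lemma sum_single_keys:
  "(\<Sum>u\<in>Poly_Mapping.keys \<gamma>. Poly_Mapping.single u (Poly_Mapping.lookup \<gamma> u)) = \<gamma>"
  by (rule poly_mapping_eqI) (simp add: lookup_sum lookup_single when_def in_keys_iff sum.delta)

lemma evaluate_mult: "evaluate (\<gamma> * \<delta>) v = evaluate \<gamma> v * evaluate \<delta> v"
proof -
  have "\<gamma> * \<delta> = (\<Sum>u\<in>Poly_Mapping.keys \<gamma>. \<Sum>w\<in>Poly_Mapping.keys \<delta>.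
      Poly_Mapping.single (u + w) (Poly_Mapping.lookup \<gamma> u * Poly_Mapping.lookup \<delta> w))"
    by (subst (1 2) sum_single_keys[symmetric]) (simp only: sum_product mult_single)
  then have "evaluate (\<gamma> * \<delta>) v = (\<Sum>u\<in>Poly_Mapping.keys \<gamma>. \<Sum>w\<in>Poly_Mapping.keys \<delta>.
      ([:Poly_Mapping.lookup \<gamma> u:] * eval_exponent v u)
      * ([:Poly_Mapping.lookup \<delta> w:] * eval_exponent v w))"
    by (simp add: evaluate_sum evaluate_single eval_exponent_add mult.commute)
  then show ?thesis
    by (simp only: evaluate_def sum_product)
qed

lemma evaluate_Const: "evaluate (Const c) v = [:c:]"
  by (simp add: Const_def evaluate_single)

lemma evaluate_one: "evaluate 1 v = 1"
  using evaluate_Const[of 1 v] by (simp add: Const_def one_pCons)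

lemma evaluate_power: "evaluate (\<gamma> ^ n) v = evaluate \<gamma> v ^ n"
  by (induction n) (simp_all add: evaluate_one evaluate_mult)

lemma evaluate_prod: "evaluate (\<Prod>i\<in>S. f i) v = (\<Prod>i\<in>S. evaluate (f i) v)"
  by (induction S rule: infinite_finite_induct) (simp_all add: evaluate_one evaluate_mult)

lemma evaluate_X: "evaluate (X g) v = v g"
  by (simp add: X_def evaluate_single eval_exponent_def)

lemma keys_subset_carrier:
  assumes "\<gamma> \<in> near_ring G" "u \<in> Poly_Mapping.keys \<gamma>"
  shows "Poly_Mapping.keys u \<subseteq> carrier G"
  using assms unfolding near_ring_def exponents_def by auto

lemma evaluate_cong:
  assumes "\<gamma> \<in> near_ring G" "\<And>g. g \<in> carrier G \<Longrightarrow> v g = w g"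
  shows "evaluate \<gamma> v = evaluate \<gamma> w"
  unfolding evaluate_def eval_exponent_def
  using assms keys_subset_carrier[OF assms(1)]
  by (intro sum.cong prod.cong arg_cong2[of _ _ _ _ "(*)"] refl) (metis subsetD)

lemma evaluate_closed:
  assumes "unital_subring R"
    and "\<forall>u\<in>Poly_Mapping.keys \<gamma>. [:Poly_Mapping.lookup \<gamma> u:] \<in> R"
    and "\<And>u h. u \<in> Poly_Mapping.keys \<gamma> \<Longrightarrow> h \<in> Poly_Mapping.keys u \<Longrightarrow> v h \<in> R"
  shows "evaluate \<gamma> v \<in> R"
proof -
  interpret unital_subring R by fact
  show ?thesis
    unfolding evaluate_def eval_exponent_def using assms(2,3)
    by (intro sum_closed mult_closed prod_closed power_closed) auto
qed

text \<open>The monomial of \<open>g u\<close> has the exponent \<open>u(h)\<close> at the indeterminate of \<open>g h\<close>.\<close>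

lemma eval_exponent_act_exp:
  fixes G (structure)
  assumes "group G" "g \<in> carrier G" "Poly_Mapping.keys u \<subseteq> carrier G"
  shows "eval_exponent v (act_exp G g u) = eval_exponent (\<lambda>h. v (g \<otimes> h)) u"
proof -
  interpret group G by fact
  have inj: "inj_on (\<lambda>h. g \<otimes> h) (Poly_Mapping.keys u)"
    using assms(2,3) by (intro inj_onI) (metis Units_eq Units_l_cancel subsetD)
  have lookup: "Poly_Mapping.lookup (act_exp G g u) (g \<otimes> h) = Poly_Mapping.lookup u h"
    if "h \<in> carrier G" for h
    using assms(1,2) that by (simp add: lookup_act_exp flip: m_assoc)
  have "Poly_Mapping.keys (act_exp G g u) \<subseteq> (\<lambda>h. g \<otimes> h) ` Poly_Mapping.keys u"
  proof
    fix h assume "h \<in> Poly_Mapping.keys (act_exp G g u)"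
    then have h: "h \<in> carrier G" "inv g \<otimes> h \<in> Poly_Mapping.keys u"
      using assms(1,2) by (auto simp: in_keys_iff lookup_act_exp split: if_splits)
    moreover have "h = g \<otimes> (inv g \<otimes> h)"
      using h assms(2) by (simp flip: m_assoc)
    ultimately show "h \<in> (\<lambda>h. g \<otimes> h) ` Poly_Mapping.keys u" by blast
  qed
  then have "eval_exponent v (act_exp G g u)
      = (\<Prod>h\<in>(\<lambda>h. g \<otimes> h) ` Poly_Mapping.keys u. v h ^ Poly_Mapping.lookup (act_exp G g u) h)"
    by (intro eval_exponent_superset) auto
  also have "\<dots> = (\<Prod>h\<in>Poly_Mapping.keys u. v (g \<otimes> h) ^ Poly_Mapping.lookup u h)"
    using assms(3) lookup by (subst prod.reindex[OF inj]) (auto intro!: prod.cong)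
  finally show ?thesis
    by (simp add: eval_exponent_def)
qed

lemma evaluate_act:
  fixes G (structure)
  assumes "group G" "g \<in> carrier G" "\<gamma> \<in> near_ring G"
  shows "evaluate (act G g \<gamma>) v = evaluate \<gamma> (\<lambda>h. v (g \<otimes> h))"
proof -
  have "evaluate (act G g \<gamma>) v = (\<Sum>u\<in>Poly_Mapping.keys \<gamma>.
      [:Poly_Mapping.lookup \<gamma> u:] * eval_exponent v (act_exp G g u))"
    by (simp add: act_def evaluate_sum evaluate_mult evaluate_Const evaluate_single
        monomial_eq_single)
  also have "\<dots> = evaluate \<gamma> (\<lambda>h. v (g \<otimes> h))"
    unfolding evaluate_def using assms keys_subset_carrier[OF assms(3)]
    by (intro sum.cong refl) (simp add: eval_exponent_act_exp)
  finally show ?thesis .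
qed

text \<open>The near-ring product is composition: the right-hand side is the value at the identity of the
  automaton of \<open>\<alpha>\<close> applied to the image of \<open>v\<close> under the automaton of \<open>\<beta>\<close>.\<close>

lemma evaluate_star:
  fixes G (structure)
  assumes "group G" "\<alpha> \<in> near_ring G" "\<beta> \<in> near_ring G"
  shows "evaluate (star G \<alpha> \<beta>) v = evaluate \<alpha> (\<lambda>g. evaluate \<beta> (\<lambda>h. v (g \<otimes> h)))"
proof -
  have "evaluate (star G \<alpha> \<beta>) v = evaluate \<alpha> (\<lambda>g. evaluate (act G g \<beta>) v)"
    unfolding star_def evaluate_def[of \<alpha>] eval_exponent_def
    by (simp only: evaluate_sum evaluate_mult evaluate_Const evaluate_prod evaluate_power)
  also have "\<dots> = evaluate \<alpha> (\<lambda>g. evaluate \<beta> (\<lambda>h. v (g \<otimes> h)))"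
    using assms by (intro evaluate_cong[OF assms(2)] evaluate_act)
  finally show ?thesis .
qed

section \<open>A point where a nonzero element does not vanish\<close>

text \<open>Kronecker substitution: the \<open>u h\<close> are read off as digits of the weighted sum in a
  base exceeding all of them.\<close>

lemma separating_weights:
  assumes "finite S" "finite (U :: ('a \<Rightarrow> nat) set)"
  shows "\<exists>w. \<forall>u\<in>U. \<forall>u'\<in>U. (\<Sum>h\<in>S. w h * u h) = (\<Sum>h\<in>S. w h * u' h) \<longrightarrow> (\<forall>h\<in>S. u h = u' h)"
  using assms(1)
proof induction
  case empty
  then show ?case by simp
next
  case (insert x S)
  then obtain w where w: "\<And>u u'. u \<in> U \<Longrightarrow> u' \<in> U \<Longrightarrow>
      (\<Sum>h\<in>S. w h * u h) = (\<Sum>h\<in>S. w h * u' h) \<Longrightarrow> \<forall>h\<in>S. u h = u' h"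
    by blast
  obtain N where N: "\<And>u. u \<in> U \<Longrightarrow> u x < N"
    using finite_nat_set_iff_bounded[of "(\<lambda>u. u x) ` U"] assms(2) by auto
  define w' where "w' h = (if h = x then 1 else N * w h)" for h
  have sum: "(\<Sum>h\<in>insert x S. w' h * u h) = u x + N * (\<Sum>h\<in>S. w h * u h)" for u
  proof -
    have "(\<Sum>h\<in>S. w' h * u h) = N * (\<Sum>h\<in>S. w h * u h)"
      using insert.hyps unfolding sum_distrib_left
      by (intro sum.cong) (auto simp: w'_def mult.assoc)
    then show ?thesis
      using insert.hyps by (simp add: w'_def)
  qed
  have "\<forall>h\<in>insert x S. u h = u' h"
    if "u \<in> U" "u' \<in> U" "(\<Sum>h\<in>insert x S. w' h * u h) = (\<Sum>h\<in>insert x S. w' h * u' h)" for u u'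
  proof -
    let ?s = "\<lambda>u. \<Sum>h\<in>S. w h * u h"
    have eq: "u x + N * ?s u = u' x + N * ?s u'"
      using that(3) unfolding sum .
    have mod: "(a + N * b) mod N = a" "(a + N * b) div N = b" if "a < N" for a b
      using that by simp_all
    have "u x = u' x" "?s u = ?s u'"
      using mod[OF N[OF that(1)], of "?s u"] mod[OF N[OF that(2)], of "?s u'"] eq by simp_all
    then show ?thesis
      using w that by blast
  qed
  then show ?case by blast
qed

text \<open>After the substitution of \<open>T^(w h)\<close> for the indeterminate of \<open>h\<close>, the monomials of \<open>\<gamma>\<close> become
  distinct powers of \<open>T\<close>, so nothing cancels.\<close>

lemma nonvanishing_point:
  fixes \<gamma> :: "('a \<Rightarrow>\<^sub>0 nat) \<Rightarrow>\<^sub>0 'k::field"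
  assumes "\<gamma> \<noteq> 0"
  obtains w where "evaluate \<gamma> (\<lambda>h. monom 1 1 ^ w h) \<noteq> 0"
proof -
  define S where "S = (\<Union>u\<in>Poly_Mapping.keys \<gamma>. Poly_Mapping.keys u)"
  have S: "finite S" "\<And>u. u \<in> Poly_Mapping.keys \<gamma> \<Longrightarrow> Poly_Mapping.keys u \<subseteq> S"
    unfolding S_def by auto
  obtain w where w: "\<And>u u'. u \<in> Poly_Mapping.keys \<gamma> \<Longrightarrow> u' \<in> Poly_Mapping.keys \<gamma> \<Longrightarrow>
      (\<Sum>h\<in>S. w h * Poly_Mapping.lookup u h) = (\<Sum>h\<in>S. w h * Poly_Mapping.lookup u' h) \<Longrightarrow>
      \<forall>h\<in>S. Poly_Mapping.lookup u h = Poly_Mapping.lookup u' h"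
    using separating_weights[OF S(1), of "Poly_Mapping.lookup ` Poly_Mapping.keys \<gamma>"] by auto
  define wt where "wt u = (\<Sum>h\<in>S. w h * Poly_Mapping.lookup u h)" for u
  have inj: "u = u'"
    if "u \<in> Poly_Mapping.keys \<gamma>" "u' \<in> Poly_Mapping.keys \<gamma>" "wt u = wt u'" for u u'
  proof (rule poly_mapping_eqI)
    fix h
    show "Poly_Mapping.lookup u h = Poly_Mapping.lookup u' h"
    proof (cases "h \<in> S")
      case True
      then show ?thesis
        using w that unfolding wt_def by blast
    next
      case False
      then have "h \<notin> Poly_Mapping.keys u" "h \<notin> Poly_Mapping.keys u'"
        using S(2) that by blast+
      then show ?thesis
        by (simp add: in_keys_iff)
    qed
  qed
  have prod_monom: "(\<Prod>h\<in>T. monom 1 (f h)) = monom (1::'k) (\<Sum>h\<in>T. f h)"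
    for T and f :: "'a \<Rightarrow> nat"
    by (induction T rule: infinite_finite_induct) (simp_all add: mult_monom)
  have "eval_exponent (\<lambda>h. monom 1 1 ^ w h) u = monom (1::'k) (wt u)"
    if "u \<in> Poly_Mapping.keys \<gamma>" for u
    using eval_exponent_superset[OF S(1) S(2)[OF that], of "\<lambda>h. monom (1::'k) 1 ^ w h"]
    by (simp add: monom_power prod_monom wt_def)
  then have "evaluate \<gamma> (\<lambda>h. monom 1 1 ^ w h)
      = (\<Sum>u\<in>Poly_Mapping.keys \<gamma>. monom (Poly_Mapping.lookup \<gamma> u) (wt u))"
    unfolding evaluate_def by (intro sum.cong) (simp_all add: smult_monom)
  moreover obtain u where u: "u \<in> Poly_Mapping.keys \<gamma>"
    using assms by (metis ex_in_conv keys_eq_empty)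
  moreover have "coeff (\<Sum>u\<in>Poly_Mapping.keys \<gamma>. monom (Poly_Mapping.lookup \<gamma> u) (wt u)) (wt u)
      = (\<Sum>u'\<in>Poly_Mapping.keys \<gamma>. if u' = u then Poly_Mapping.lookup \<gamma> u' else 0)"
    unfolding coeff_sum using inj u by (intro sum.cong) auto
  ultimately have "coeff (evaluate \<gamma> (\<lambda>h. monom 1 1 ^ w h)) (wt u) \<noteq> 0"
    by (simp add: in_keys_iff)
  then show thesis
    using that by fastforce
qed

section \<open>Cellular automata over a finite residue ring\<close>

text \<open>\<open>\<rho>\<close> picks the representative of a coset of \<open>J\<close>, and \<open>\<rho> ` R\<close> is the residue ring \<open>R/J\<close> as an
  alphabet.\<close>

locale residue_automata = group G + R: ideal_in R J
  for G :: "('a, 'b) monoid_scheme" (structure) and R J :: "'k::field poly set" +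
  fixes \<rho> :: "'k poly \<Rightarrow> 'k poly"
  assumes finite_alphabet: "finite (\<rho> ` R)"
    and alphabet_subset: "\<rho> ` R \<subseteq> R"
    and rep_cong: "a \<in> R \<Longrightarrow> a - \<rho> a \<in> J"
    and rep_eqI: "a \<in> R \<Longrightarrow> b \<in> R \<Longrightarrow> a - b \<in> J \<Longrightarrow> \<rho> a = \<rho> b"
begin

definition near_ring_over :: "(('a \<Rightarrow>\<^sub>0 nat) \<Rightarrow>\<^sub>0 'k) set" where
  "near_ring_over =
     {\<gamma> \<in> near_ring G. \<forall>u\<in>Poly_Mapping.keys \<gamma>. [:Poly_Mapping.lookup \<gamma> u:] \<in> R}"

definition reduce :: "('a \<Rightarrow> 'k poly) \<Rightarrow> 'a \<Rightarrow> 'k poly" where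
  "reduce v = (\<lambda>g\<in>carrier G. \<rho> (v g))"

definition automaton ::
    "(('a \<Rightarrow>\<^sub>0 nat) \<Rightarrow>\<^sub>0 'k) \<Rightarrow> ('a \<Rightarrow> 'k poly) \<Rightarrow> 'a \<Rightarrow> 'k poly" where
  "automaton \<gamma> c = reduce (\<lambda>g. evaluate \<gamma> (\<lambda>h. c (g \<otimes> h)))"

lemma rep_closed: "a \<in> R \<Longrightarrow> \<rho> a \<in> R"
  using alphabet_subset by blast

lemma rep_eqD:
  assumes "\<rho> a = \<rho> b" "a \<in> R" "b \<in> R"
  shows "a - b \<in> J"
  using R.ideal_diff[OF rep_cong[OF assms(2)] rep_cong[OF assms(3)]] assms(1) by simp

lemma rep_rep:
  assumes "a \<in> R"
  shows "\<rho> (\<rho> a) = \<rho> a"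
  using R.ideal_diff[OF R.ideal_zero rep_cong[OF assms]] assms
  by (intro rep_eqI rep_closed) auto

lemma evaluate_cong_mod:
  assumes \<gamma>: "\<gamma> \<in> near_ring_over"
    and v: "\<And>h. h \<in> carrier G \<Longrightarrow> v h \<in> R" and w: "\<And>h. h \<in> carrier G \<Longrightarrow> w h \<in> R"
    and vw: "\<And>h. h \<in> carrier G \<Longrightarrow> v h - w h \<in> J"
  shows "evaluate \<gamma> v - evaluate \<gamma> w \<in> J"
proof -
  have keys: "Poly_Mapping.keys u \<subseteq> carrier G" "[:Poly_Mapping.lookup \<gamma> u:] \<in> R"
    if "u \<in> Poly_Mapping.keys \<gamma>" for u
    using \<gamma> that keys_subset_carrier unfolding near_ring_over_def by auto
  have "eval_exponent v u - eval_exponent w u \<in> J" if "u \<in> Poly_Mapping.keys \<gamma>" for u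
    unfolding eval_exponent_def using keys(1)[OF that] v w vw
    by (intro R.cong_prod R.cong_power R.power_closed) auto
  then have "(\<Sum>u\<in>Poly_Mapping.keys \<gamma>.
      [:Poly_Mapping.lookup \<gamma> u:] * (eval_exponent v u - eval_exponent w u)) \<in> J"
    using keys(2) by (intro R.ideal_sum R.ideal_mult)
  then show ?thesis
    unfolding evaluate_def sum_subtractf[symmetric] right_diff_distrib[symmetric] .
qed

lemma reduce_in_configs: "(\<And>g. g \<in> carrier G \<Longrightarrow> v g \<in> R) \<Longrightarrow> reduce v \<in> configs G (\<rho> ` R)"
  by (auto simp: reduce_def configs_def)

lemma configs_in_subring: "c \<in> configs G (\<rho> ` R) \<Longrightarrow> g \<in> carrier G \<Longrightarrow> c g \<in> R"
  using alphabet_subset by (auto simp: configs_def)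

lemma reduce_configs:
  assumes "c \<in> configs G (\<rho> ` R)"
  shows "reduce c = c"
proof
  fix g
  show "reduce c g = c g"
  proof (cases "g \<in> carrier G")
    case True
    then obtain a where "a \<in> R" "c g = \<rho> a"
      using assms by (auto simp: configs_def)
    then show ?thesis
      using True by (simp add: reduce_def rep_rep)
  next
    case False
    then have "c g = undefined"
      using assms unfolding configs_def by (rule PiE_arb[rotated])
    then show ?thesis
      using False by (simp add: reduce_def)
  qed
qed

lemma evaluate_shift_closed:
  assumes "\<gamma> \<in> near_ring_over" "\<And>h. h \<in> carrier G \<Longrightarrow> v h \<in> R" "g \<in> carrier G"
  shows "evaluate \<gamma> (\<lambda>h. v (g \<otimes> h)) \<in> R"
proof (intro evaluate_closed[OF R.unital_subring_axioms] assms(2) m_closed assms(3))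
  show "\<forall>u\<in>Poly_Mapping.keys \<gamma>. [:Poly_Mapping.lookup \<gamma> u:] \<in> R"
    using assms(1) by (simp add: near_ring_over_def)
next
  fix u h assume "u \<in> Poly_Mapping.keys \<gamma>" "h \<in> Poly_Mapping.keys u"
  then show "h \<in> carrier G"
    using assms(1) keys_subset_carrier[of \<gamma> G u] by (auto simp: near_ring_over_def)
qed

text \<open>Reduction modulo \<open>J\<close> commutes with the action of \<open>\<gamma>\<close>, since polynomials respect congruences.
  This transports identities from \<open>R\<close>-valued to alphabet-valued configurations.\<close>

lemma automaton_reduce:
  assumes \<gamma>: "\<gamma> \<in> near_ring_over" and v: "\<And>g. g \<in> carrier G \<Longrightarrow> v g \<in> R"
  shows "automaton \<gamma> (reduce v) = reduce (\<lambda>g. evaluate \<gamma> (\<lambda>h. v (g \<otimes> h)))"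
proof -
  have red: "reduce v h \<in> R" "reduce v h - v h \<in> J" if "h \<in> carrier G" for h
    using that v R.ideal_diff[OF R.ideal_zero rep_cong[OF v[OF that]]]
    by (auto simp: reduce_def rep_closed)
  have "\<rho> (evaluate \<gamma> (\<lambda>h. reduce v (g \<otimes> h))) = \<rho> (evaluate \<gamma> (\<lambda>h. v (g \<otimes> h)))"
    if "g \<in> carrier G" for g
    using \<gamma> v red that by (intro rep_eqI evaluate_shift_closed evaluate_cong_mod) auto
  then show ?thesis
    unfolding automaton_def by (auto simp: reduce_def[of "\<lambda>g. evaluate \<gamma> (_ g)"])
qed

lemma automaton_star:
  assumes \<alpha>: "\<alpha> \<in> near_ring_over" and \<beta>: "\<beta> \<in> near_ring_over"
    and v: "\<And>g. g \<in> carrier G \<Longrightarrow> v g \<in> R"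
  shows "automaton \<alpha> (automaton \<beta> (reduce v))
    = reduce (\<lambda>g. evaluate (star G \<alpha> \<beta>) (\<lambda>h. v (g \<otimes> h)))"
proof -
  have near: "\<alpha> \<in> near_ring G" "\<beta> \<in> near_ring G"
    using \<alpha> \<beta> by (auto simp: near_ring_over_def)
  have "automaton \<alpha> (automaton \<beta> (reduce v))
      = reduce (\<lambda>g. evaluate \<alpha> (\<lambda>h. evaluate \<beta> (\<lambda>h'. v (g \<otimes> h \<otimes> h'))))"
    using \<alpha> \<beta> v by (simp add: automaton_reduce evaluate_shift_closed)
  moreover have "evaluate \<alpha> (\<lambda>h. evaluate \<beta> (\<lambda>h'. v (g \<otimes> h \<otimes> h')))
      = evaluate (star G \<alpha> \<beta>) (\<lambda>h. v (g \<otimes> h))" if "g \<in> carrier G" for g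
    unfolding evaluate_star[OF is_group near] using that
    by (intro evaluate_cong[OF near(1)] evaluate_cong[OF near(2)]) (simp add: m_assoc)
  ultimately show ?thesis
    by (auto simp: reduce_def)
qed

text \<open>The memory set consists of the indices of the indeterminates that occur in \<open>\<gamma>\<close>.\<close>

lemma cellular_automaton_automaton:
  assumes \<gamma>: "\<gamma> \<in> near_ring_over"
  shows "cellular_automaton G (\<rho> ` R) (automaton \<gamma>)"
proof -
  define M where "M = (\<Union>u\<in>Poly_Mapping.keys \<gamma>. Poly_Mapping.keys u)"
  have M: "finite M" "M \<subseteq> carrier G"
    using \<gamma> keys_subset_carrier unfolding M_def near_ring_over_def by fastforce+
  define \<mu> where "\<mu> p = \<rho> (evaluate \<gamma> p)" for p
  have "\<mu> \<in> (M \<rightarrow>\<^sub>E \<rho> ` R) \<rightarrow> \<rho> ` R"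
  proof
    fix p assume "p \<in> M \<rightarrow>\<^sub>E \<rho> ` R"
    then have "evaluate \<gamma> p \<in> R"
      using \<gamma> alphabet_subset by (intro evaluate_closed[OF R.unital_subring_axioms])
        (auto simp: M_def PiE_iff near_ring_over_def)
    then show "\<mu> p \<in> \<rho> ` R"
      by (simp add: \<mu>_def)
  qed
  moreover have "automaton \<gamma> c g = \<mu> (restrict (shift G (inv g) c) M)"
    if "g \<in> carrier G" for c g
  proof -
    have "evaluate \<gamma> (restrict (shift G (inv g) c) M) = evaluate \<gamma> (\<lambda>h. c (g \<otimes> h))"
      unfolding evaluate_def eval_exponent_def
    proof (intro sum.cong prod.cong arg_cong2[of _ _ _ _ "(*)"] refl)
      fix u h assume "u \<in> Poly_Mapping.keys \<gamma>" "h \<in> Poly_Mapping.keys u"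
      then have "h \<in> M" "h \<in> carrier G"
        using M by (auto simp: M_def)
      then show "restrict (shift G (inv g) c) M h ^ Poly_Mapping.lookup u h
          = c (g \<otimes> h) ^ Poly_Mapping.lookup u h"
        using that by (simp add: shift_def)
    qed
    then show ?thesis
      using that by (simp add: automaton_def reduce_def \<mu>_def)
  qed
  moreover have "automaton \<gamma> \<in> configs G (\<rho> ` R) \<rightarrow> configs G (\<rho> ` R)"
    unfolding automaton_def using configs_in_subring evaluate_shift_closed[OF \<gamma>]
    by (auto intro!: reduce_in_configs)
  ultimately show ?thesis
    unfolding cellular_automaton_def using M by blast
qed

lemma automaton_inverse:
  assumes \<alpha>: "\<alpha> \<in> near_ring_over" and \<beta>: "\<beta> \<in> near_ring_over"
    and star: "star G \<alpha> \<beta> = X \<one>" and c: "c \<in> configs G (\<rho> ` R)"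
  shows "automaton \<alpha> (automaton \<beta> c) = c"
proof -
  have "automaton \<alpha> (automaton \<beta> (reduce c)) = reduce c"
    using automaton_star[OF \<alpha> \<beta> configs_in_subring[OF c]]
    by (auto simp: star evaluate_X reduce_def)
  then show ?thesis
    by (simp add: reduce_configs[OF c])
qed

end

theorem theorem5p1:
  fixes G :: "('a, 'b) monoid_scheme" (structure)
    and \<alpha> \<beta> :: "('a \<Rightarrow>\<^sub>0 nat) \<Rightarrow>\<^sub>0 'k::field"
  assumes "group G"
    and "surjunctive G"
    and "\<alpha> \<in> near_ring G"
    and "\<beta> \<in> near_ring G"
    and "star G \<alpha> \<beta> = X \<one>"
  shows "star G \<beta> \<alpha> = X \<one>"
proof (rule ccontr)
  interpret group G by fact
  assume "star G \<beta> \<alpha> \<noteq> X \<one>"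
  then have "star G \<beta> \<alpha> - X \<one> \<noteq> 0"
    by simp
  then obtain w where w: "evaluate (star G \<beta> \<alpha> - X \<one>) (\<lambda>h. monom 1 1 ^ w h) \<noteq> 0"
    by (rule nonvanishing_point)
  define v :: "'a \<Rightarrow> 'k poly" where "v h = monom 1 1 ^ w h" for h
  define r where "r = evaluate (star G \<beta> \<alpha>) v - v \<one>"
  have "r \<noteq> 0"
    using w unfolding evaluate_diff evaluate_X r_def v_def[abs_def] .
  define C where "C = insert (monom 1 1)
    ((\<lambda>u. [:Poly_Mapping.lookup \<alpha> u:]) ` Poly_Mapping.keys \<alpha>
      \<union> (\<lambda>u. [:Poly_Mapping.lookup \<beta> u:]) ` Poly_Mapping.keys \<beta>)"
  have "finite C"
    by (simp add: C_def)
  then obtain R where C: "C \<subseteq> R" and R: "unit_mod_finite R"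
    by (rule finite_subset_unit_mod_finite)
  interpret R: unital_subring R
    using R unfolding unit_mod_finite_def by blast
  have v: "v h \<in> R" for h
    unfolding v_def using C by (intro R.power_closed) (auto simp: C_def)
  have coeffs: "\<forall>u\<in>Poly_Mapping.keys \<alpha>. [:Poly_Mapping.lookup \<alpha> u:] \<in> R"
    "\<forall>u\<in>Poly_Mapping.keys \<beta>. [:Poly_Mapping.lookup \<beta> u:] \<in> R"
    using C by (auto simp: C_def)
  have star_R: "evaluate (star G \<beta> \<alpha>) v \<in> R"
    unfolding evaluate_star[OF assms(1,4,3)] using v coeffs
    by (intro evaluate_closed[OF R.unital_subring_axioms])
  then have "r \<in> R"
    unfolding r_def using v by (intro R.diff_closed)
  then obtain J r' where J: "ideal_in R J" "1 \<notin> J" "finite_index R J"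
    and r': "r' \<in> R" "r * r' - 1 \<in> J"
    using R \<open>r \<noteq> 0\<close> unfolding unit_mod_finite_def by blast
  \<comment> \<open>A unit modulo the proper ideal \<open>J\<close> does not vanish modulo \<open>J\<close>.\<close>
  have "r \<notin> J"
    using ideal_in.unit_not_in_ideal[OF J(1,2) r'(2,1)] .
  obtain \<rho> where \<rho>: "finite (\<rho> ` R)" "\<rho> ` R \<subseteq> R" "\<And>a. a \<in> R \<Longrightarrow> a - \<rho> a \<in> J"
    "\<And>a b. a \<in> R \<Longrightarrow> b \<in> R \<Longrightarrow> a - b \<in> J \<Longrightarrow> \<rho> a = \<rho> b"
    using finite_index_representatives[OF J(1,3)] by blast
  interpret residue_automata G R J \<rho>
    by (intro residue_automata.intro residue_automata_axioms.intro assms(1) J(1) \<rho>)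
  have sub: "\<alpha> \<in> near_ring_over" "\<beta> \<in> near_ring_over"
    using assms(3,4) coeffs by (auto simp: near_ring_over_def)
  have inverse: "automaton \<alpha> (automaton \<beta> c) = c" if "c \<in> configs G (\<rho> ` R)" for c
    using automaton_inverse[OF sub assms(5) that] .
  have "inj_on (automaton \<beta>) (configs G (\<rho> ` R))"
    by (rule inj_on_inverseI) (rule inverse)
  then have "automaton \<beta> ` configs G (\<rho> ` R) = configs G (\<rho> ` R)"
    using surjunctiveD[OF assms(1,2) \<rho>(1) cellular_automaton_automaton[OF sub(2)]] by blast
  then obtain d where "d \<in> configs G (\<rho> ` R)" "reduce v = automaton \<beta> d"
    using reduce_in_configs[of v] v by blast
  then have "automaton \<beta> (automaton \<alpha> (reduce v)) = reduce v"
    using inverse by simp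
  then have "reduce (\<lambda>g. evaluate (star G \<beta> \<alpha>) (\<lambda>h. v (g \<otimes> h))) \<one> = reduce v \<one>"
    using automaton_star[OF sub(2,1), of v] v by simp
  moreover have "evaluate (star G \<beta> \<alpha>) (\<lambda>h. v (\<one> \<otimes> h)) = evaluate (star G \<beta> \<alpha>) v"
    unfolding evaluate_star[OF assms(1,4,3)]
    by (intro evaluate_cong[OF assms(4)] evaluate_cong[OF assms(3)]) simp
  ultimately have "\<rho> (evaluate (star G \<beta> \<alpha>) v) = \<rho> (v \<one>)"
    by (simp add: reduce_def)
  then have "r \<in> J"
    unfolding r_def using star_R v by (rule rep_eqD)
  with \<open>r \<notin> J\<close> show False ..
qed

end
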